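(* Let $\mathcal{C}$ and $\mathcal{M}$ be cocomplete (locally small) categories and $U:\mathcal{C}\to\mathcal{M}$ a faithful functor preserving colimits. Assume that $\mathcal{M}$ is also complete, that $\mathcal{C}$ is co-wellpowered and has a set of generators, and that $\mathcal{C}$ and $\mathcal{M}$ have initial objects $0$ with $U(0)=0$. Then $\mathcal{C}$ is complete (has all small limits), and limits are computed as follows. Let $F:\mathcal{A}\to\mathcal{C}$ be a functor from a small category, let $P=\varprojlim UF$ be the limit of $UF$ in $\mathcal{M}$, with canonical morphisms $q_a:P\to UF(a)$, $a\in\mathcal{A}$. Let $(E_0,p_0)=(\mathcal{H}_0(P,(q_a)_a),p_0)$, $p_0:U(E_0)\to P$. Then each $\pi_a=q_ap_0$ is a morphism in $\mathcal{C}$, and $(E_0,(\pi_a)_{a\in\mathcal{A}})$ is the limit of $F$ in $\mathcal{C}$.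
   Context: For a faithful functor $U:\mathcal{C}\to\mathcal{M}$, a morphism $f:U(C)\to U(C')$ of $\mathcal{M}$ is said to be a morphism in $\mathcal{C}$ if $f=U(g)$ for some (necessarily unique) $g\in\mathrm{Hom}_{\mathcal{C}}(C,C')$; then $f$ and $g$ are identified. A category is co-wellpowered if for every object $C$ the equivalence classes of epimorphisms with source $C$ form a set. A set $\mathcal{G}$ of objects is a set of generators if for any two distinct parallel morphisms $u\neq v:X\to Y$ there are $G\in\mathcal{G}$ and $h:G\to X$ with $uh\neq vh$. Given an object $N$ of $\mathcal{M}$ and morphisms $f_i:N\to U(C_i)$, $i\in I$, in $\mathcal{M}$ (with $I$ a set and $C_i$ objects of $\mathcal{C}$), $(\mathcal{H}_0(N,(f_i)_i),p_0)$ denotes the final object (which exists under the present hypotheses) of the category $\mathcal{H}$ whose objects are the pairs $(E,p)$ with $E\in\mathcal{C}$ and $p:U(E)\to N$ a morphism in $\mathcal{M}$ such that $f_ip$ is a morphism in $\mathcal{C}$ for all $i\in I$, and whose morphisms $(E,p)\to(E',p')$ are the morphisms $h:E\to E'$ in $\mathcal{C}$ with $p'U(h)=p$. *)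

theory Defs
  imports Main "HOL-Library.Equipollence"
begin

text \<open>
  A type \<open>'u\<close> plays the role of the universe of sets, and a set (over any type) is small if it is
  strictly smaller than this universe. The predicate \<open>universe\<close> says that the cardinality of \<open>'u\<close>
  is a regular strong limit, i.e. that the small sets are those of a Grothendieck universe. As
  in the usual definition of Grothendieck universes without an axiom of infinity, the universe
  of hereditarily finite sets is not excluded.
\<close>

definition small :: "'u itself \<Rightarrow> 'a set \<Rightarrow> bool" where
  "small T S \<longleftrightarrow> S \<prec> (UNIV :: 'u set)"

definition universe :: "'u itself \<Rightarrow> bool" where
  "universe T \<longleftrightarrow>
     infinite (UNIV :: 'u set) \<and>
     (\<forall>(S :: 'u set) (B :: 'u \<Rightarrow> 'u set).
        small T S \<longrightarrow> (\<forall>s\<in>S. small T (B s)) \<longrightarrow> small T (\<Union>s\<in>S. B s)) \<and>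
     (\<forall>S :: 'u set. small T S \<longrightarrow> small T (Pow S))"

record ('o, 'm) cat =
  Obj :: "'o set"
  Arr :: "'m set"
  Dom :: "'m \<Rightarrow> 'o"
  Cod :: "'m \<Rightarrow> 'o"
  Id :: "'o \<Rightarrow> 'm"
  Comp :: "'m \<Rightarrow> 'm \<Rightarrow> 'm" (infixl "\<cdot>\<index>" 70)

text \<open>Composition is in applicative order: \<open>g \<cdot>\<^bsub>C\<^esub> f\<close> is \<open>f\<close> followed by \<open>g\<close>.\<close>

definition hom :: "('o, 'm) cat \<Rightarrow> 'o \<Rightarrow> 'o \<Rightarrow> 'm set" where
  "hom C X Y = {f \<in> Arr C. Dom C f = X \<and> Cod C f = Y}"

definition category :: "('o, 'm) cat \<Rightarrow> bool" where
  "category C \<longleftrightarrow>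
     (\<forall>f\<in>Arr C. Dom C f \<in> Obj C \<and> Cod C f \<in> Obj C) \<and>
     (\<forall>X\<in>Obj C. Id C X \<in> hom C X X) \<and>
     (\<forall>f\<in>Arr C. \<forall>g\<in>Arr C. Dom C g = Cod C f \<longrightarrow> g \<cdot>\<^bsub>C\<^esub> f \<in> hom C (Dom C f) (Cod C g)) \<and>
     (\<forall>f\<in>Arr C. f \<cdot>\<^bsub>C\<^esub> Id C (Dom C f) = f \<and> Id C (Cod C f) \<cdot>\<^bsub>C\<^esub> f = f) \<and>
     (\<forall>f\<in>Arr C. \<forall>g\<in>Arr C. \<forall>h\<in>Arr C. Dom C g = Cod C f \<longrightarrow> Dom C h = Cod C g \<longrightarrow>
        h \<cdot>\<^bsub>C\<^esub> (g \<cdot>\<^bsub>C\<^esub> f) = (h \<cdot>\<^bsub>C\<^esub> g) \<cdot>\<^bsub>C\<^esub> f)"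

definition locally_small :: "'u itself \<Rightarrow> ('o, 'm) cat \<Rightarrow> bool" where
  "locally_small T C \<longleftrightarrow> (\<forall>X\<in>Obj C. \<forall>Y\<in>Obj C. small T (hom C X Y))"

definition small_category :: "'u itself \<Rightarrow> ('o, 'm) cat \<Rightarrow> bool" where
  "small_category T C \<longleftrightarrow> category C \<and> small T (Obj C) \<and> small T (Arr C)"

definition is_initial :: "('o, 'm) cat \<Rightarrow> 'o \<Rightarrow> bool" where
  "is_initial C Z \<longleftrightarrow> Z \<in> Obj C \<and> (\<forall>X\<in>Obj C. \<exists>!h. h \<in> hom C Z X)"

definition is_final :: "('o, 'm) cat \<Rightarrow> 'o \<Rightarrow> bool" where
  "is_final C Z \<longleftrightarrow> Z \<in> Obj C \<and> (\<forall>X\<in>Obj C. \<exists>!h. h \<in> hom C X Z)"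

definition is_epi :: "('o, 'm) cat \<Rightarrow> 'm \<Rightarrow> bool" where
  "is_epi C e \<longleftrightarrow> e \<in> Arr C \<and>
     (\<forall>Y\<in>Obj C. \<forall>u\<in>hom C (Cod C e) Y. \<forall>v\<in>hom C (Cod C e) Y. u \<cdot>\<^bsub>C\<^esub> e = v \<cdot>\<^bsub>C\<^esub> e \<longrightarrow> u = v)"

definition is_iso :: "('o, 'm) cat \<Rightarrow> 'm \<Rightarrow> bool" where
  "is_iso C i \<longleftrightarrow> i \<in> Arr C \<and>
     (\<exists>j\<in>hom C (Cod C i) (Dom C i). j \<cdot>\<^bsub>C\<^esub> i = Id C (Dom C i) \<and> i \<cdot>\<^bsub>C\<^esub> j = Id C (Cod C i))"

definition epis_from :: "('o, 'm) cat \<Rightarrow> 'o \<Rightarrow> 'm set" where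
  "epis_from C X = {e. is_epi C e \<and> Dom C e = X}"

definition epi_equiv :: "('o, 'm) cat \<Rightarrow> 'o \<Rightarrow> ('m \<times> 'm) set" where
  "epi_equiv C X = {(e, e'). e \<in> epis_from C X \<and> e' \<in> epis_from C X \<and>
     (\<exists>i\<in>hom C (Cod C e) (Cod C e'). is_iso C i \<and> i \<cdot>\<^bsub>C\<^esub> e = e')}"

definition co_wellpowered :: "'u itself \<Rightarrow> ('o, 'm) cat \<Rightarrow> bool" where
  "co_wellpowered T C \<longleftrightarrow> (\<forall>X\<in>Obj C. small T (epis_from C X // epi_equiv C X))"

definition is_generating :: "('o, 'm) cat \<Rightarrow> 'o set \<Rightarrow> bool" where
  "is_generating C \<G> \<longleftrightarrow> \<G> \<subseteq> Obj C \<and>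
     (\<forall>X\<in>Obj C. \<forall>Y\<in>Obj C. \<forall>u\<in>hom C X Y. \<forall>v\<in>hom C X Y. u \<noteq> v \<longrightarrow>
        (\<exists>G\<in>\<G>. \<exists>h\<in>hom C G X. u \<cdot>\<^bsub>C\<^esub> h \<noteq> v \<cdot>\<^bsub>C\<^esub> h))"

record ('o, 'm, 'p, 'n) func =
  omap :: "'o \<Rightarrow> 'p"
  amap :: "'m \<Rightarrow> 'n"

definition is_functor :: "('o, 'm) cat \<Rightarrow> ('p, 'n) cat \<Rightarrow> ('o, 'm, 'p, 'n) func \<Rightarrow> bool" where
  "is_functor C D F \<longleftrightarrow> category C \<and> category D \<and>
     (\<forall>X\<in>Obj C. omap F X \<in> Obj D) \<and>
     (\<forall>f\<in>Arr C. amap F f \<in> hom D (omap F (Dom C f)) (omap F (Cod C f))) \<and>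
     (\<forall>X\<in>Obj C. amap F (Id C X) = Id D (omap F X)) \<and>
     (\<forall>f\<in>Arr C. \<forall>g\<in>Arr C. Dom C g = Cod C f \<longrightarrow>
        amap F (g \<cdot>\<^bsub>C\<^esub> f) = amap F g \<cdot>\<^bsub>D\<^esub> amap F f)"

definition func_comp ::
  "('p, 'n, 'q, 'k) func \<Rightarrow> ('o, 'm, 'p, 'n) func \<Rightarrow> ('o, 'm, 'q, 'k) func" where
  "func_comp G F = \<lparr>omap = omap G \<circ> omap F, amap = amap G \<circ> amap F\<rparr>"

definition is_faithful :: "('o, 'm) cat \<Rightarrow> ('o, 'm, 'p, 'n) func \<Rightarrow> bool" where
  "is_faithful C F \<longleftrightarrow> (\<forall>X\<in>Obj C. \<forall>Y\<in>Obj C. inj_on (amap F) (hom C X Y))"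

definition is_cone ::
  "('a, 'b) cat \<Rightarrow> ('o, 'm) cat \<Rightarrow> ('a, 'b, 'o, 'm) func \<Rightarrow> 'o \<Rightarrow> ('a \<Rightarrow> 'm) \<Rightarrow> bool" where
  "is_cone J C F L \<pi> \<longleftrightarrow> L \<in> Obj C \<and>
     (\<forall>a\<in>Obj J. \<pi> a \<in> hom C L (omap F a)) \<and>
     (\<forall>u\<in>Arr J. amap F u \<cdot>\<^bsub>C\<^esub> \<pi> (Dom J u) = \<pi> (Cod J u))"

definition is_limit ::
  "('a, 'b) cat \<Rightarrow> ('o, 'm) cat \<Rightarrow> ('a, 'b, 'o, 'm) func \<Rightarrow> 'o \<Rightarrow> ('a \<Rightarrow> 'm) \<Rightarrow> bool" where
  "is_limit J C F L \<pi> \<longleftrightarrow> is_cone J C F L \<pi> \<and>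
     (\<forall>X \<xi>. is_cone J C F X \<xi> \<longrightarrow> (\<exists>!h. h \<in> hom C X L \<and> (\<forall>a\<in>Obj J. \<pi> a \<cdot>\<^bsub>C\<^esub> h = \<xi> a)))"

definition is_cocone ::
  "('a, 'b) cat \<Rightarrow> ('o, 'm) cat \<Rightarrow> ('a, 'b, 'o, 'm) func \<Rightarrow> 'o \<Rightarrow> ('a \<Rightarrow> 'm) \<Rightarrow> bool" where
  "is_cocone J C F L \<iota> \<longleftrightarrow> L \<in> Obj C \<and>
     (\<forall>a\<in>Obj J. \<iota> a \<in> hom C (omap F a) L) \<and>
     (\<forall>u\<in>Arr J. \<iota> (Cod J u) \<cdot>\<^bsub>C\<^esub> amap F u = \<iota> (Dom J u))"

definition is_colimit ::
  "('a, 'b) cat \<Rightarrow> ('o, 'm) cat \<Rightarrow> ('a, 'b, 'o, 'm) func \<Rightarrow> 'o \<Rightarrow> ('a \<Rightarrow> 'm) \<Rightarrow> bool" where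
  "is_colimit J C F L \<iota> \<longleftrightarrow> is_cocone J C F L \<iota> \<and>
     (\<forall>X \<xi>. is_cocone J C F X \<xi> \<longrightarrow> (\<exists>!h. h \<in> hom C L X \<and> (\<forall>a\<in>Obj J. h \<cdot>\<^bsub>C\<^esub> \<iota> a = \<xi> a)))"

text \<open>
  Every small category is isomorphic to one whose objects and arrows are elements of \<open>'u\<close>, so it is
  enough to quantify over diagrams of such shapes.
\<close>

definition complete_cat :: "'u itself \<Rightarrow> ('o, 'm) cat \<Rightarrow> bool" where
  "complete_cat T C \<longleftrightarrow>
     (\<forall>(J :: ('u, 'u) cat) F. small_category T J \<and> is_functor J C F \<longrightarrow>
        (\<exists>L \<pi>. is_limit J C F L \<pi>))"

definition cocomplete_cat :: "'u itself \<Rightarrow> ('o, 'm) cat \<Rightarrow> bool" where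
  "cocomplete_cat T C \<longleftrightarrow>
     (\<forall>(J :: ('u, 'u) cat) F. small_category T J \<and> is_functor J C F \<longrightarrow>
        (\<exists>L \<iota>. is_colimit J C F L \<iota>))"

definition preserves_colimits ::
  "'u itself \<Rightarrow> ('o, 'm) cat \<Rightarrow> ('p, 'n) cat \<Rightarrow> ('o, 'm, 'p, 'n) func \<Rightarrow> bool" where
  "preserves_colimits T C D U \<longleftrightarrow>
     (\<forall>(J :: ('u, 'u) cat) F L \<iota>. small_category T J \<and> is_functor J C F \<and> is_colimit J C F L \<iota> \<longrightarrow>
        is_colimit J D (func_comp U F) (omap U L) (amap U \<circ> \<iota>))"

text \<open>
  For faithful \<open>U\<close> and objects \<open>X\<close>, \<open>Y\<close> of \<open>C\<close>: a morphism \<open>f\<close> from \<open>U X\<close> to \<open>U Y\<close> is a morphism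
  in \<open>C\<close> if it is the image of some \<open>g\<close> from \<open>X\<close> to \<open>Y\<close>; this unique \<open>g\<close>, with which
  \<open>f\<close> is identified, is \<open>lift_mor C U X Y f\<close>.
\<close>

definition is_mor_in ::
  "('o, 'm) cat \<Rightarrow> ('o, 'm, 'p, 'n) func \<Rightarrow> 'o \<Rightarrow> 'o \<Rightarrow> 'n \<Rightarrow> bool" where
  "is_mor_in C U X Y f \<longleftrightarrow> (\<exists>g\<in>hom C X Y. amap U g = f)"

definition lift_mor ::
  "('o, 'm) cat \<Rightarrow> ('o, 'm, 'p, 'n) func \<Rightarrow> 'o \<Rightarrow> 'o \<Rightarrow> 'n \<Rightarrow> 'm" where
  "lift_mor C U X Y f = (THE g. g \<in> hom C X Y \<and> amap U g = f)"

text \<open>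
  The category of pairs \<open>(E, p)\<close> attached to morphisms \<open>f i\<close> from \<open>N\<close> to \<open>U (Y i)\<close>, \<open>i \<in> I\<close>. Its
  arrows are triples of source, underlying morphism of \<open>C\<close>, and target.
\<close>

definition H_obj ::
  "('o, 'm) cat \<Rightarrow> ('p, 'n) cat \<Rightarrow> ('o, 'm, 'p, 'n) func \<Rightarrow> 'p \<Rightarrow> 'i set \<Rightarrow> ('i \<Rightarrow> 'o) \<Rightarrow> ('i \<Rightarrow> 'n)
    \<Rightarrow> ('o \<times> 'n) set" where
  "H_obj C M U N I Y f =
     {(E, p). E \<in> Obj C \<and> p \<in> hom M (omap U E) N \<and>
        (\<forall>i\<in>I. is_mor_in C U E (Y i) (f i \<cdot>\<^bsub>M\<^esub> p))}"

definition H_cat ::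
  "('o, 'm) cat \<Rightarrow> ('p, 'n) cat \<Rightarrow> ('o, 'm, 'p, 'n) func \<Rightarrow> 'p \<Rightarrow> 'i set \<Rightarrow> ('i \<Rightarrow> 'o) \<Rightarrow> ('i \<Rightarrow> 'n)
    \<Rightarrow> ('o \<times> 'n, ('o \<times> 'n) \<times> 'm \<times> ('o \<times> 'n)) cat" where
  "H_cat C M U N I Y f =
     \<lparr>Obj = H_obj C M U N I Y f,
      Arr = {((E, p), h, (E', p')) | E p h E' p'.
               (E, p) \<in> H_obj C M U N I Y f \<and> (E', p') \<in> H_obj C M U N I Y f \<and>
               h \<in> hom C E E' \<and> p' \<cdot>\<^bsub>M\<^esub> amap U h = p},
      Dom = (\<lambda>(s, h, t). s),
      Cod = (\<lambda>(s, h, t). t),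
      Id = (\<lambda>s. (s, Id C (fst s), s)),
      Comp = (\<lambda>(s', h', t') (s, h, t). (s, h' \<cdot>\<^bsub>C\<^esub> h, t'))\<rparr>"

end

theory Submission
  imports Defs
begin

text \<open>
  Colimits in the category \<open>H\<close> of pairs \<open>(E, p)\<close> are computed in \<open>C\<close>: as \<open>U\<close> preserves colimits, the
  maps \<open>p\<close> glue, and so do the lifts of the \<open>f i \<circ> p\<close>. Let \<open>L\<close> be the colimit of all pairs over the
  generators. For a pair \<open>E\<close>, adjoining \<open>E\<close> to this diagram gives a colimit \<open>R\<close>, and \<open>L \<rightarrow> R\<close> is epi since
  the pairs over the generators detect morphisms out of \<open>E\<close>. As \<open>C\<close> is co-wellpowered, \<open>H\<close> has a
  weakly final small set of objects, and the colimit of the full subcategory on it and on the pairs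
  over the generators is final. If \<open>N\<close> is the limit of \<open>U F\<close>, then a cone on \<open>F\<close> with vertex \<open>X\<close> amounts
  to an object \<open>(X, p)\<close> of \<open>H\<close>, so a final object of \<open>H\<close> is a limit of \<open>F\<close>.
\<close>

subsection \<open>Small sets\<close>

lemma small_subset: "small T B \<Longrightarrow> A \<subseteq> B \<Longrightarrow> small T A"
  unfolding small_def by (metis lesspoll_trans1 subset_imp_lepoll)

lemma small_image: "small T A \<Longrightarrow> small T (g ` A)"
  unfolding small_def by (metis image_lepoll lesspoll_trans1)

lemma small_inj:
  assumes "small (T :: 'u itself) A"
  obtains g :: "'a \<Rightarrow> 'u" where "inj_on g A"
  using assms unfolding small_def lesspoll_def lepoll_def by blast

lemma small_inj_image_iff: "inj_on g A \<Longrightarrow> small T (g ` A) \<longleftrightarrow> small T A"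
  by (metis small_image the_inv_into_onto)

lemma small_finite: "universe T \<Longrightarrow> finite A \<Longrightarrow> small T A"
  unfolding small_def universe_def by (meson finite_lesspoll_infinite)

text \<open>Regularity in \<open>universe\<close> concerns families of subsets of \<open>'u\<close>
  indexed by a subset of \<open>'u\<close>. Index set and fibres are therefore embedded into
  \<open>'u\<close>, where the sum lands in a small union.\<close>

lemma small_Sigma:
  assumes univ: "universe (T :: 'u itself)" and A: "small T A" and B: "\<And>a. a \<in> A \<Longrightarrow> small T (B a)"
  shows "small T (Sigma A B)"
proof -
  obtain i :: "'a \<Rightarrow> 'u" where i: "inj_on i A"
    using A by (rule small_inj)
  have "\<forall>a\<in>A. \<exists>g :: 'b \<Rightarrow> 'u. inj_on g (B a)"
    using B small_inj by metis
  then obtain g :: "'a \<Rightarrow> 'b \<Rightarrow> 'u" where g: "\<And>a. a \<in> A \<Longrightarrow> inj_on (g a) (B a)"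
    by metis
  have "infinite (UNIV :: 'u set)"
    using univ by (simp add: universe_def)
  \<comment> \<open>An infinite set is equipollent to its square; this provides an injective pairing
    on \<open>'u\<close>.\<close>
  then have "(card_of ((UNIV :: 'u set) \<times> (UNIV :: 'u set)), card_of (UNIV :: 'u set)) \<in> ordIso"
    by (rule card_of_Times_same_infinite)
  then obtain pr :: "'u \<times> 'u \<Rightarrow> 'u" where "bij_betw pr UNIV UNIV"
    using card_of_ordIso by (metis UNIV_Times_UNIV)
  then have pr: "inj pr"
    by (simp add: bij_betw_def)
  \<comment> \<open>Each fibre is tagged with its index, so that \<open>Sigma A B\<close> embeds
    into the union of the fibres.\<close>
  define B' where "B' = (\<lambda>x. pr ` ({x} \<times> g (the_inv_into A i x) ` B (the_inv_into A i x)))"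
  have "small T (B' x)" if x: "x \<in> i ` A" for x
  proof -
    obtain a where a: "a \<in> A" "x = i a" using x by blast
    have "B' x = (\<lambda>b. pr (x, g a b)) ` B a"
      using a i by (auto simp: B'_def the_inv_into_f_f)
    then show ?thesis using B[OF a(1)] by (simp add: small_image)
  qed
  then have "small T (\<Union>x\<in>i ` A. B' x)"
    using univ small_image[OF A, of i] unfolding universe_def by blast
  moreover have "inj_on (\<lambda>(a, b). pr (i a, g a b)) (Sigma A B)"
    by (auto intro!: inj_onI simp: inj_eq[OF pr] inj_on_eq_iff[OF i] inj_on_eq_iff[OF g])
  moreover have "(\<lambda>(a, b). pr (i a, g a b)) ` Sigma A B \<subseteq> (\<Union>x\<in>i ` A. B' x)"
    using i by (auto simp: B'_def the_inv_into_f_f)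
  ultimately show ?thesis
    by (metis small_inj_image_iff small_subset)
qed

lemma small_UN:
  assumes "universe T" and "small T A" and "\<And>a. a \<in> A \<Longrightarrow> small T (B a)"
  shows "small T (\<Union>a\<in>A. B a)"
proof -
  have "(\<Union>a\<in>A. B a) = snd ` Sigma A B" by force
  then show ?thesis using assms by (simp add: small_Sigma small_image)
qed

lemma small_Un:
  assumes "universe T" and "small T A" and "small T B"
  shows "small T (A \<union> B)"
proof -
  have "A \<union> B = (\<Union>b\<in>UNIV. if b then A else B)" by (auto split: if_splits)
  then show ?thesis using small_UN[of T UNIV "\<lambda>b. if b then A else B"] assms
    by (simp add: small_finite)
qed

lemma small_insert: "universe T \<Longrightarrow> small T A \<Longrightarrow> small T (insert x A)"
  by (metis insert_is_Un small_Un small_finite finite.emptyI finite.insertI)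

subsection \<open>Categories and functors\<close>

lemma hom_in_Obj: "category C \<Longrightarrow> f \<in> hom C X Y \<Longrightarrow> X \<in> Obj C \<and> Y \<in> Obj C"
  unfolding category_def hom_def by blast

lemma Id_in_hom: "category C \<Longrightarrow> X \<in> Obj C \<Longrightarrow> Id C X \<in> hom C X X"
  unfolding category_def by blast

lemma comp_in_hom:
  "category C \<Longrightarrow> f \<in> hom C X Y \<Longrightarrow> g \<in> hom C Y Z \<Longrightarrow> g \<cdot>\<^bsub>C\<^esub> f \<in> hom C X Z"
  unfolding category_def by (auto simp: hom_def)

lemma comp_Id: "category C \<Longrightarrow> f \<in> hom C X Y \<Longrightarrow> f \<cdot>\<^bsub>C\<^esub> Id C X = f"
  unfolding category_def hom_def by blast

lemma Id_comp: "category C \<Longrightarrow> f \<in> hom C X Y \<Longrightarrow> Id C Y \<cdot>\<^bsub>C\<^esub> f = f"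
  unfolding category_def hom_def by blast

lemma assoc_hom:
  "category C \<Longrightarrow> f \<in> hom C X Y \<Longrightarrow> g \<in> hom C Y Z \<Longrightarrow> h \<in> hom C Z W \<Longrightarrow>
     (h \<cdot>\<^bsub>C\<^esub> g) \<cdot>\<^bsub>C\<^esub> f = h \<cdot>\<^bsub>C\<^esub> (g \<cdot>\<^bsub>C\<^esub> f)"
  unfolding category_def by (simp add: hom_def)

lemma amap_in_hom:
  "is_functor C D F \<Longrightarrow> f \<in> hom C X Y \<Longrightarrow> amap F f \<in> hom D (omap F X) (omap F Y)"
  unfolding is_functor_def by (auto simp: hom_def)

lemma amap_comp:
  "is_functor C D F \<Longrightarrow> f \<in> hom C X Y \<Longrightarrow> g \<in> hom C Y Z \<Longrightarrow>
     amap F (g \<cdot>\<^bsub>C\<^esub> f) = amap F g \<cdot>\<^bsub>D\<^esub> amap F f"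
  unfolding is_functor_def hom_def by auto

lemma omap_in_Obj: "is_functor C D F \<Longrightarrow> X \<in> Obj C \<Longrightarrow> omap F X \<in> Obj D"
  unfolding is_functor_def by blast

lemma amap_Id: "is_functor C D F \<Longrightarrow> X \<in> Obj C \<Longrightarrow> amap F (Id C X) = Id D (omap F X)"
  unfolding is_functor_def by blast

lemma faithfulD:
  "category C \<Longrightarrow> is_faithful C F \<Longrightarrow> f \<in> hom C X Y \<Longrightarrow> g \<in> hom C X Y \<Longrightarrow> amap F f = amap F g \<Longrightarrow> f = g"
  by (meson hom_in_Obj inj_onD is_faithful_def)

lemma lift_mor_eq:
  assumes "category C" and "is_faithful C F" and "g \<in> hom C X Y"
  shows "lift_mor C F X Y (amap F g) = g"
  unfolding lift_mor_def using assms by (blast intro: faithfulD)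

lemma lift_mor_in_hom:
  assumes "category C" and "is_faithful C F" and "is_mor_in C F X Y f"
  shows "lift_mor C F X Y f \<in> hom C X Y" and "amap F (lift_mor C F X Y f) = f"
  using assms lift_mor_eq unfolding is_mor_in_def by metis+

lemma is_functor_func_comp:
  assumes F: "is_functor A B F" and G: "is_functor B C G"
  shows "is_functor A C (func_comp G F)"
  using assms unfolding is_functor_def func_comp_def by (auto simp: hom_def)

text \<open>Both \<open>h\<close> and \<open>k\<close> factor the cocone obtained by composing
  \<open>\<iota>\<close> with \<open>h\<close>, and such a factorization is unique.\<close>

lemma colimit_ext:
  assumes colim: "is_colimit J C F L \<iota>" and cat: "category C" and fun_F: "is_functor J C F"
    and h: "h \<in> hom C L Z" and k: "k \<in> hom C L Z"
    and eq: "\<And>a. a \<in> Obj J \<Longrightarrow> h \<cdot>\<^bsub>C\<^esub> \<iota> a = k \<cdot>\<^bsub>C\<^esub> \<iota> a"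
  shows "h = k"
proof -
  have i: "\<iota> a \<in> hom C (omap F a) L" if "a \<in> Obj J" for a
    using colim that by (simp add: is_colimit_def is_cocone_def)
  have "is_cocone J C F Z (\<lambda>a. h \<cdot>\<^bsub>C\<^esub> \<iota> a)"
    unfolding is_cocone_def
  proof (intro conjI ballI)
    show "Z \<in> Obj C" using hom_in_Obj[OF cat h] by simp
    show "h \<cdot>\<^bsub>C\<^esub> \<iota> a \<in> hom C (omap F a) Z" if "a \<in> Obj J" for a
      using comp_in_hom[OF cat i[OF that] h] .
    fix u assume u: "u \<in> Arr J"
    then have u': "u \<in> hom J (Dom J u) (Cod J u)" by (simp add: hom_def)
    have "category J" using fun_F by (simp add: is_functor_def)
    then have "Cod J u \<in> Obj J" using hom_in_Obj u' by metis
    moreover have "\<iota> (Cod J u) \<cdot>\<^bsub>C\<^esub> amap F u = \<iota> (Dom J u)"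
      using colim u by (simp add: is_colimit_def is_cocone_def)
    ultimately show "h \<cdot>\<^bsub>C\<^esub> \<iota> (Cod J u) \<cdot>\<^bsub>C\<^esub> amap F u = h \<cdot>\<^bsub>C\<^esub> \<iota> (Dom J u)"
      using assoc_hom[OF cat amap_in_hom[OF fun_F u'] i h] by simp
  qed
  then have "\<exists>!g. g \<in> hom C L Z \<and> (\<forall>a\<in>Obj J. g \<cdot>\<^bsub>C\<^esub> \<iota> a = h \<cdot>\<^bsub>C\<^esub> \<iota> a)"
    using colim by (simp add: is_colimit_def)
  then show ?thesis using h k eq by (metis (no_types, lifting))
qed

subsection \<open>Diagram shapes on arbitrary types\<close>

text \<open>Cocompleteness and preservation of colimits are stated for shapes on \<open>'u\<close>,
  whereas the shapes built below consist of pairs and triples. Injections \<open>i\<close> and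
  \<open>j\<close> carry such a shape to \<open>'u\<close>; \<open>the_inv_into\<close> is
  meaningful only on their images.\<close>

definition transport_cat :: "('a \<Rightarrow> 'c) \<Rightarrow> ('b \<Rightarrow> 'd) \<Rightarrow> ('a, 'b) cat \<Rightarrow> ('c, 'd) cat" where
  "transport_cat i j J =
    \<lparr>Obj = i ` Obj J, Arr = j ` Arr J,
     Dom = i \<circ> Dom J \<circ> the_inv_into (Arr J) j,
     Cod = i \<circ> Cod J \<circ> the_inv_into (Arr J) j,
     Id = j \<circ> Id J \<circ> the_inv_into (Obj J) i,
     Comp = (\<lambda>g f. j (the_inv_into (Arr J) j g \<cdot>\<^bsub>J\<^esub> the_inv_into (Arr J) j f))\<rparr>"

definition transport_func ::
  "('a \<Rightarrow> 'c) \<Rightarrow> ('b \<Rightarrow> 'd) \<Rightarrow> ('a, 'b) cat \<Rightarrow> ('a, 'b, 'o, 'm) func \<Rightarrow> ('c, 'd, 'o, 'm) func" where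
  "transport_func i j J F =
    \<lparr>omap = omap F \<circ> the_inv_into (Obj J) i, amap = amap F \<circ> the_inv_into (Arr J) j\<rparr>"

lemma category_Arr:
  assumes "category J" and "f \<in> Arr J"
  shows "Dom J f \<in> Obj J" and "Cod J f \<in> Obj J"
  using assms by (auto simp: category_def)

lemma category_Id:
  assumes "category J" and "X \<in> Obj J"
  shows "Id J X \<in> Arr J" and "Dom J (Id J X) = X" and "Cod J (Id J X) = X"
  using assms by (auto simp: category_def hom_def)

lemma category_Comp:
  assumes "category J" and "f \<in> Arr J" and "g \<in> Arr J" and "Dom J g = Cod J f"
  shows "g \<cdot>\<^bsub>J\<^esub> f \<in> Arr J" and "Dom J (g \<cdot>\<^bsub>J\<^esub> f) = Dom J f" and "Cod J (g \<cdot>\<^bsub>J\<^esub> f) = Cod J g"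
  using assms by (auto simp: category_def hom_def)

context
  fixes i :: "'a \<Rightarrow> 'c" and j :: "'b \<Rightarrow> 'd" and J :: "('a, 'b) cat"
  assumes i: "inj_on i (Obj J)" and j: "inj_on j (Arr J)" and J: "category J"
begin

lemma category_transport: "category (transport_cat i j J)"
  unfolding category_def transport_cat_def hom_def
  using J by (auto simp: the_inv_into_f_f[OF i] the_inv_into_f_f[OF j] category_Arr category_Id
      category_Comp inj_on_eq_iff[OF i]) (auto simp: category_def)

lemma functor_transport:
  assumes "is_functor J C F"
  shows "is_functor (transport_cat i j J) C (transport_func i j J F)"
  using assms category_transport J
  unfolding is_functor_def
  by (auto simp: the_inv_into_f_f[OF i] the_inv_into_f_f[OF j] category_Arr category_Id
      category_Comp inj_on_eq_iff[OF i] transport_func_def transport_cat_def)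

lemma cocone_transport:
  "is_cocone (transport_cat i j J) C (transport_func i j J F) L \<iota> \<longleftrightarrow> is_cocone J C F L (\<iota> \<circ> i)"
  unfolding is_cocone_def transport_cat_def transport_func_def
  by (auto simp: the_inv_into_f_f[OF i] the_inv_into_f_f[OF j])

lemma colimit_transport:
  assumes "is_colimit (transport_cat i j J) C (transport_func i j J F) L \<iota>"
  shows "is_colimit J C F L (\<iota> \<circ> i)"
  unfolding is_colimit_def
proof (intro conjI allI impI)
  show "is_cocone J C F L (\<iota> \<circ> i)"
    using assms unfolding is_colimit_def cocone_transport by blast
  fix X \<xi> assume xi: "is_cocone J C F X \<xi>"
  \<comment> \<open>The family \<open>\<xi>\<close> is moved to the transported shape along the
    inverse of \<open>i\<close>. Coming back along \<open>i\<close> can change it only outside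
    \<open>Obj J\<close>, where a cocone is unconstrained.\<close>
  have "is_cocone J C F X ((\<xi> \<circ> the_inv_into (Obj J) i) \<circ> i)"
    using xi J by (auto simp: is_cocone_def the_inv_into_f_f[OF i] category_Arr)
  moreover have "Obj (transport_cat i j J) = i ` Obj J"
    by (simp add: transport_cat_def)
  ultimately have "\<exists>!h. h \<in> hom C L X \<and>
      (\<forall>a\<in>i ` Obj J. h \<cdot>\<^bsub>C\<^esub> \<iota> a = (\<xi> \<circ> the_inv_into (Obj J) i) a)"
    using assms unfolding is_colimit_def cocone_transport by presburger
  then show "\<exists>!h. h \<in> hom C L X \<and> (\<forall>a\<in>Obj J. h \<cdot>\<^bsub>C\<^esub> (\<iota> \<circ> i) a = \<xi> a)"
    by (simp add: the_inv_into_f_f[OF i])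
qed

end

text \<open>Transport to \<open>'u\<close> and back makes both hypotheses available for small shapes
  on any types. One vertex and one cocone serve in \<open>C\<close> and, through \<open>U\<close>,
  in \<open>M\<close>.\<close>

lemma small_colimit_preserved:
  fixes J :: "('a, 'b) cat"
  assumes cocomplete: "cocomplete_cat (T :: 'u itself) C" and pres: "preserves_colimits T C M U"
    and J: "small_category T J" and F: "is_functor J C F"
  obtains L \<iota> where "is_colimit J C F L \<iota>"
    and "is_colimit J M (func_comp U F) (omap U L) (amap U \<circ> \<iota>)"
proof -
  have cat: "category J" and "small T (Obj J)" and "small T (Arr J)"
    using J by (auto simp: small_category_def)
  then obtain i :: "'a \<Rightarrow> 'u" and j :: "'b \<Rightarrow> 'u" where ij: "inj_on i (Obj J)" "inj_on j (Arr J)"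
    by (metis small_inj)
  let ?J = "transport_cat i j J" and ?F = "transport_func i j J F"
  have J': "small_category T ?J"
    using J category_transport[OF ij cat]
    by (simp add: small_category_def transport_cat_def small_image)
  have F': "is_functor ?J C ?F" using functor_transport[OF ij cat F] .
  obtain L \<iota> where colim: "is_colimit ?J C ?F L \<iota>"
    using cocomplete J' F' unfolding cocomplete_cat_def by blast
  then have "is_colimit ?J M (func_comp U ?F) (omap U L) (amap U \<circ> \<iota>)"
    using pres J' F' unfolding preserves_colimits_def by blast
  \<comment> \<open>Transport commutes with composition with \<open>U\<close>, so the colimit in
    \<open>M\<close> can be moved back as well.\<close>
  moreover have "func_comp U ?F = transport_func i j J (func_comp U F)"
    by (simp add: func_comp_def transport_func_def comp_assoc)
  ultimately show thesis
    using that colimit_transport[OF ij cat] colim by (metis comp_assoc)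
qed

definition full_subcat :: "('o, 'm) cat \<Rightarrow> 'o set \<Rightarrow> ('o, 'm) cat" where
  "full_subcat D S = D\<lparr>Obj := S, Arr := {f \<in> Arr D. Dom D f \<in> S \<and> Cod D f \<in> S}\<rparr>"

lemma category_full_subcat: "category D \<Longrightarrow> S \<subseteq> Obj D \<Longrightarrow> category (full_subcat D S)"
  unfolding category_def full_subcat_def hom_def by auto

subsection \<open>The category of pairs\<close>

text \<open>For the limit theorem, \<open>N\<close> is the vertex of a limit of
  \<open>func_comp U F\<close>, \<open>I\<close> the set of objects of the shape, \<open>Y\<close>
  the object map of \<open>F\<close>, and \<open>f\<close> the family of projections.\<close>

locale lifting_problem =
  fixes T :: "'u itself"
    and C :: "('oc, 'mc) cat"
    and M :: "('om, 'mm) cat"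
    and U :: "('oc, 'mc, 'om, 'mm) func"
    and N :: 'om
    and I :: "'i set"
    and Y :: "'i \<Rightarrow> 'oc"
    and f :: "'i \<Rightarrow> 'mm"
  assumes univ: "universe T"
    and catC: "category C" and locally_small_C: "locally_small T C"
    and cocomplete_C: "cocomplete_cat T C"
    and catM: "category M" and locally_small_M: "locally_small T M"
    and functor_U: "is_functor C M U" and faithful_U: "is_faithful C U"
    and preserves_U: "preserves_colimits T C M U"
    and N_Obj: "N \<in> Obj M"
    and Y_Obj: "i \<in> I \<Longrightarrow> Y i \<in> Obj C"
    and f_hom: "i \<in> I \<Longrightarrow> f i \<in> hom M N (omap U (Y i))"
begin

abbreviation HO where "HO \<equiv> H_obj C M U N I Y f"

abbreviation H where "H \<equiv> H_cat C M U N I Y f"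

text \<open>The morphisms of \<open>C\<close> underlying arrows of \<open>H\<close>, freed of the
  source and target that these carry; membership of \<open>s\<close> and \<open>t\<close> in
  \<open>HO\<close> is assumed separately where it matters.\<close>

definition H_hom :: "'oc \<times> 'mm \<Rightarrow> 'oc \<times> 'mm \<Rightarrow> 'mc set" where
  "H_hom s t = {h \<in> hom C (fst s) (fst t). snd t \<cdot>\<^bsub>M\<^esub> amap U h = snd s}"

lemma HO_D:
  assumes "s \<in> HO"
  shows "fst s \<in> Obj C" and "snd s \<in> hom M (omap U (fst s)) N"
    and "i \<in> I \<Longrightarrow> is_mor_in C U (fst s) (Y i) (f i \<cdot>\<^bsub>M\<^esub> snd s)"
  using assms by (auto simp: H_obj_def)

lemma H_hom_D:
  assumes "h \<in> H_hom s t"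
  shows "h \<in> hom C (fst s) (fst t)" and "snd t \<cdot>\<^bsub>M\<^esub> amap U h = snd s"
  using assms by (auto simp: H_hom_def)

text \<open>If \<open>g\<close> lifts \<open>f i\<close> after \<open>snd s\<close>, then
  \<open>g\<close> after \<open>h\<close> lifts the new composite. This yields pairs over generators
  and over chosen codomains of epis.\<close>

lemma H_obj_precomp:
  assumes s: "s \<in> HO" and h: "h \<in> hom C X (fst s)"
  shows "(X, snd s \<cdot>\<^bsub>M\<^esub> amap U h) \<in> HO"
proof -
  have "is_mor_in C U X (Y i) (f i \<cdot>\<^bsub>M\<^esub> (snd s \<cdot>\<^bsub>M\<^esub> amap U h))" if i: "i \<in> I" for i
  proof -
    obtain g where g: "g \<in> hom C (fst s) (Y i)" "amap U g = f i \<cdot>\<^bsub>M\<^esub> snd s"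
      using HO_D(3)[OF s i] by (auto simp: is_mor_in_def)
    have "amap U (g \<cdot>\<^bsub>C\<^esub> h) = f i \<cdot>\<^bsub>M\<^esub> (snd s \<cdot>\<^bsub>M\<^esub> amap U h)"
      using amap_comp[OF functor_U h g(1)] g(2)
        assoc_hom[OF catM amap_in_hom[OF functor_U h] HO_D(2)[OF s] f_hom[OF i]] by simp
    then show ?thesis
      using comp_in_hom[OF catC h g(1)] by (auto simp: is_mor_in_def)
  qed
  moreover have "snd s \<cdot>\<^bsub>M\<^esub> amap U h \<in> hom M (omap U X) N"
    using comp_in_hom[OF catM amap_in_hom[OF functor_U h] HO_D(2)[OF s]] .
  ultimately show ?thesis
    using hom_in_Obj[OF catC h] by (simp add: H_obj_def)
qed

lemma H_hom_comp:
  assumes r: "t \<in> HO" and h: "h \<in> H_hom r s" and k: "k \<in> H_hom s t"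
  shows "k \<cdot>\<^bsub>C\<^esub> h \<in> H_hom r t"
proof -
  note h' = H_hom_D[OF h] and k' = H_hom_D[OF k]
  have "snd t \<cdot>\<^bsub>M\<^esub> amap U (k \<cdot>\<^bsub>C\<^esub> h) = snd r"
    using assoc_hom[OF catM amap_in_hom[OF functor_U h'(1)] amap_in_hom[OF functor_U k'(1)]
        HO_D(2)[OF r]]
    by (simp add: amap_comp[OF functor_U h'(1) k'(1)] h' k')
  then show ?thesis
    using comp_in_hom[OF catC h'(1) k'(1)] by (simp add: H_hom_def)
qed

lemma Id_in_H_hom: "s \<in> HO \<Longrightarrow> Id C (fst s) \<in> H_hom s s"
  using HO_D[of s] Id_in_hom[OF catC] amap_Id[OF functor_U] comp_Id[OF catM]
  by (auto simp: H_hom_def)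

lemma Arr_H: "Arr H = {(s, h, t). s \<in> HO \<and> t \<in> HO \<and> h \<in> H_hom s t}"
  by (force simp: H_cat_def H_hom_def)

lemma H_sel:
  "Obj H = HO" "Dom H (s, h, t) = s" "Cod H (s, h, t) = t" "Id H s = (s, Id C (fst s), s)"
  "(s', h', t') \<cdot>\<^bsub>H\<^esub> (s, h, t) = (s, h' \<cdot>\<^bsub>C\<^esub> h, t')"
  by (simp_all add: H_cat_def)

lemma category_H: "category H"
  unfolding category_def hom_def Arr_H
  using H_hom_D(1) H_hom_comp Id_in_H_hom comp_Id[OF catC] Id_comp[OF catC] assoc_hom[OF catC]
  by (auto simp: H_sel) metis+

text \<open>For \<open>r\<close> and \<open>s\<close> in \<open>HO\<close>, the map
  \<open>h \<mapsto> (r, h, s)\<close> identifies \<open>H_hom r s\<close> with a hom-set of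
  \<open>H\<close>, so unique existence can be read off in \<open>C\<close>.\<close>

lemma is_final_H_iff:
  "is_final H s \<longleftrightarrow> s \<in> HO \<and> (\<forall>r\<in>HO. \<exists>!h. h \<in> H_hom r s)"
proof -
  have "(\<exists>!h. h \<in> hom H r s) \<longleftrightarrow> (\<exists>!h. h \<in> H_hom r s)" if "r \<in> HO" "s \<in> HO" for r
  proof -
    have "hom H r s = (\<lambda>h. (r, h, s)) ` H_hom r s"
      using that by (auto simp: hom_def Arr_H H_sel)
    moreover have "(\<exists>!k. k \<in> (\<lambda>h. (r, h, s)) ` K) \<longleftrightarrow> (\<exists>!h. h \<in> K)" for K :: "'mc set"
      by (rule iffI; elim ex1E; blast)
    ultimately show ?thesis by (simp only:)
  qed
  then show ?thesis
    by (cases "s \<in> HO") (simp_all add: is_final_def H_sel cong: ball_cong)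
qed

section \<open>Small diagrams in \<open>H\<close> and their colimits\<close>

lemma small_H_obj_over:
  assumes X: "small T X"
  shows "small T {s \<in> HO. fst s \<in> X}"
proof (rule small_subset)
  \<comment> \<open>The pairs over \<open>x\<close> are given by maps from \<open>omap U x\<close>
    to \<open>N\<close>, and these form a small set.\<close>
  have "small T (hom M (omap U x) N)" if "x \<in> Obj C" for x
    using locally_small_M N_Obj omap_in_Obj[OF functor_U that] by (simp add: locally_small_def)
  then show "small T (SIGMA x : X \<inter> Obj C. hom M (omap U x) N)"
    using small_Sigma[OF univ small_subset[OF X]] by (metis IntD2 inf_le1)
  show "{s \<in> HO. fst s \<in> X} \<subseteq> (SIGMA x : X \<inter> Obj C. hom M (omap U x) N)"
    using HO_D by auto
qed

text \<open>The vertex is a pair, but the universal property is tested against all objects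
  \<open>Z\<close> of \<open>C\<close>: showing that a morphism of \<open>C\<close> is epi involves
  targets that carry no map to \<open>N\<close>.\<close>

definition is_H_colimit :: "('oc \<times> 'mm) set \<Rightarrow> 'oc \<times> 'mm \<Rightarrow> ('oc \<times> 'mm \<Rightarrow> 'mc) \<Rightarrow> bool" where
  "is_H_colimit S L \<iota> \<longleftrightarrow> L \<in> HO \<and> (\<forall>s\<in>S. \<iota> s \<in> H_hom s L) \<and>
     (\<forall>s\<in>S. \<forall>t\<in>S. \<forall>m\<in>H_hom s t. \<iota> t \<cdot>\<^bsub>C\<^esub> m = \<iota> s) \<and>
     (\<forall>Z \<xi>. Z \<in> Obj C \<longrightarrow> (\<forall>s\<in>S. \<xi> s \<in> hom C (fst s) Z) \<longrightarrow>
        (\<forall>s\<in>S. \<forall>t\<in>S. \<forall>m\<in>H_hom s t. \<xi> t \<cdot>\<^bsub>C\<^esub> m = \<xi> s) \<longrightarrow>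
        (\<exists>!h. h \<in> hom C (fst L) Z \<and> (\<forall>s\<in>S. h \<cdot>\<^bsub>C\<^esub> \<iota> s = \<xi> s)))"

lemma H_colimit_D:
  assumes "is_H_colimit S L \<iota>"
  shows "L \<in> HO" and "s \<in> S \<Longrightarrow> \<iota> s \<in> H_hom s L"
    and "s \<in> S \<Longrightarrow> t \<in> S \<Longrightarrow> m \<in> H_hom s t \<Longrightarrow> \<iota> t \<cdot>\<^bsub>C\<^esub> m = \<iota> s"
  using assms by (auto simp: is_H_colimit_def)

lemma H_colimit_factor:
  assumes "is_H_colimit S L \<iota>" and "Z \<in> Obj C" and "\<And>s. s \<in> S \<Longrightarrow> \<xi> s \<in> hom C (fst s) Z"
    and "\<And>s t m. s \<in> S \<Longrightarrow> t \<in> S \<Longrightarrow> m \<in> H_hom s t \<Longrightarrow> \<xi> t \<cdot>\<^bsub>C\<^esub> m = \<xi> s"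
  obtains h where "h \<in> hom C (fst L) Z" and "\<And>s. s \<in> S \<Longrightarrow> h \<cdot>\<^bsub>C\<^esub> \<iota> s = \<xi> s"
  using assms unfolding is_H_colimit_def by (metis (no_types, lifting))

lemma H_colimit_ext:
  assumes colim: "is_H_colimit S L \<iota>" and h: "h \<in> hom C (fst L) Z" and k: "k \<in> hom C (fst L) Z"
    and eq: "\<And>s. s \<in> S \<Longrightarrow> h \<cdot>\<^bsub>C\<^esub> \<iota> s = k \<cdot>\<^bsub>C\<^esub> \<iota> s"
  shows "h = k"
proof -
  note i = H_hom_D(1)[OF H_colimit_D(2)[OF colim]]
  have "(h \<cdot>\<^bsub>C\<^esub> \<iota> t) \<cdot>\<^bsub>C\<^esub> m = h \<cdot>\<^bsub>C\<^esub> \<iota> s" if "s \<in> S" "t \<in> S" "m \<in> H_hom s t" for s t m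
    using assoc_hom[OF catC H_hom_D(1)[OF that(3)] i[OF that(2)] h] H_colimit_D(3)[OF colim that]
    by simp
  then have "\<exists>!g. g \<in> hom C (fst L) Z \<and> (\<forall>s\<in>S. g \<cdot>\<^bsub>C\<^esub> \<iota> s = h \<cdot>\<^bsub>C\<^esub> \<iota> s)"
    using colim hom_in_Obj[OF catC h] comp_in_hom[OF catC i h] unfolding is_H_colimit_def
    by simp
  then show ?thesis using h k eq by (metis (no_types, lifting))
qed

text \<open>The arrows come from the disjoint union of the hom-sets of \<open>C\<close> over pairs
  of members, which is small by local smallness.\<close>

lemma small_full_subcat_H:
  assumes S: "S \<subseteq> HO" and small: "small T S"
  shows "small_category T (full_subcat H S)"
proof -
  have "small T (hom C (fst s) (fst t))" if "s \<in> S" "t \<in> S" for s t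
    using that S HO_D(1) locally_small_C unfolding locally_small_def by blast
  then have "small T (SIGMA p : S \<times> S. hom C (fst (fst p)) (fst (snd p)))"
    using small univ by (intro small_Sigma) auto
  then have "small T ((\<lambda>((s, t), h). (s, h, t)) ` (SIGMA p : S \<times> S. hom C (fst (fst p)) (fst (snd p))))"
    by (rule small_image)
  moreover have "Arr (full_subcat H S) \<subseteq>
      (\<lambda>((s, t), h). (s, h, t)) ` (SIGMA p : S \<times> S. hom C (fst (fst p)) (fst (snd p)))"
    by (force simp: full_subcat_def Arr_H H_sel H_hom_def image_iff)
  ultimately show ?thesis
    using small S category_full_subcat[OF category_H, of S] small_subset
    by (simp add: small_category_def H_sel) (simp add: full_subcat_def)
qed

text \<open>The colimit is formed in \<open>C\<close>. Since \<open>U\<close> preserves it, a map to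
  \<open>N\<close> can be glued in \<open>M\<close>, and faithfulness makes the required lifts
  compatible.\<close>

lemma H_colimit_exists:
  assumes S: "S \<subseteq> HO" and small: "small T S"
  obtains L \<iota> where "is_H_colimit S L \<iota>"
proof -
  \<comment> \<open>\<open>?F\<close> sends a pair to its object of \<open>C\<close> and a triple to
    its middle component.\<close>
  let ?J = "full_subcat H S" and ?F = "\<lparr>omap = fst, amap = fst \<circ> snd\<rparr>"
  have Obj_J: "Obj ?J = S" by (simp add: full_subcat_def)
  have Arr_J: "Arr ?J = {(s, h, t). s \<in> S \<and> t \<in> S \<and> h \<in> H_hom s t}"
    using S by (auto simp: full_subcat_def Arr_H H_sel)
  have J_sel: "Dom ?J (s, h, t) = s" "Cod ?J (s, h, t) = t" "Id ?J s = (s, Id C (fst s), s)"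
    "(s', h', t') \<cdot>\<^bsub>?J\<^esub> (s, h, t) = (s, h' \<cdot>\<^bsub>C\<^esub> h, t')" for s h t s' h' t'
    by (simp_all add: full_subcat_def H_sel)
  have J: "small_category T ?J"
    using small_full_subcat_H[OF assms] .
  then have F: "is_functor ?J C ?F"
    using S HO_D(1) H_hom_D(1) catC
    by (auto simp: is_functor_def small_category_def Obj_J Arr_J J_sel)
  have cocone_C: "is_cocone ?J C ?F Z \<xi> \<longleftrightarrow> Z \<in> Obj C \<and> (\<forall>s\<in>S. \<xi> s \<in> hom C (fst s) Z) \<and>
      (\<forall>s\<in>S. \<forall>t\<in>S. \<forall>m\<in>H_hom s t. \<xi> t \<cdot>\<^bsub>C\<^esub> m = \<xi> s)" for Z \<xi>
    by (auto simp: is_cocone_def Obj_J Arr_J J_sel)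
  have cocone_M: "is_cocone ?J M (func_comp U ?F) N snd"
    using S HO_D(2) N_Obj by (auto simp: is_cocone_def Obj_J Arr_J J_sel func_comp_def H_hom_def)
  obtain L \<iota> where colim_C: "is_colimit ?J C ?F L \<iota>"
    and colim_M: "is_colimit ?J M (func_comp U ?F) (omap U L) (amap U \<circ> \<iota>)"
    using small_colimit_preserved[OF cocomplete_C preserves_U J F] .
  have L: "L \<in> Obj C" and i: "\<And>s. s \<in> S \<Longrightarrow> \<iota> s \<in> hom C (fst s) L"
    and compat: "\<And>s t m. s \<in> S \<Longrightarrow> t \<in> S \<Longrightarrow> m \<in> H_hom s t \<Longrightarrow> \<iota> t \<cdot>\<^bsub>C\<^esub> m = \<iota> s"
    using colim_C cocone_C by (auto simp: is_colimit_def)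
  obtain l where l: "l \<in> hom M (omap U L) N"
    and li: "\<And>s. s \<in> S \<Longrightarrow> l \<cdot>\<^bsub>M\<^esub> amap U (\<iota> s) = snd s"
    using colim_M cocone_M unfolding is_colimit_def Obj_J comp_def by blast
  \<comment> \<open>The lifts of \<open>f i\<close> after \<open>snd s\<close> are glued to a
    morphism \<open>g\<close> of \<open>C\<close>, which then lifts \<open>f i\<close> after
    \<open>l\<close>.\<close>
  have "is_mor_in C U L (Y i) (f i \<cdot>\<^bsub>M\<^esub> l)" if "i \<in> I" for i
  proof -
    define \<xi> where "\<xi> s = lift_mor C U (fst s) (Y i) (f i \<cdot>\<^bsub>M\<^esub> snd s)" for s
    have xi: "\<xi> s \<in> hom C (fst s) (Y i)" "amap U (\<xi> s) = f i \<cdot>\<^bsub>M\<^esub> snd s" if "s \<in> S" for s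
      unfolding \<xi>_def using that S HO_D(3) \<open>i \<in> I\<close> lift_mor_in_hom[OF catC faithful_U] by blast+
    have "\<xi> t \<cdot>\<^bsub>C\<^esub> m = \<xi> s" if st: "s \<in> S" "t \<in> S" and m: "m \<in> H_hom s t" for s t m
    proof (rule faithfulD[OF catC faithful_U _ xi(1)[OF st(1)]])
      note m' = H_hom_D[OF m]
      show "\<xi> t \<cdot>\<^bsub>C\<^esub> m \<in> hom C (fst s) (Y i)"
        using comp_in_hom[OF catC m'(1) xi(1)[OF st(2)]] .
      have "t \<in> HO" using st S by blast
      then show "amap U (\<xi> t \<cdot>\<^bsub>C\<^esub> m) = amap U (\<xi> s)"
        using assoc_hom[OF catM amap_in_hom[OF functor_U m'(1)] HO_D(2) f_hom[OF \<open>i \<in> I\<close>]]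
        by (simp add: amap_comp[OF functor_U m'(1) xi(1)[OF st(2)]] xi(2) st m'(2))
    qed
    then have "is_cocone ?J C ?F (Y i) \<xi>"
      using cocone_C xi(1) Y_Obj[OF \<open>i \<in> I\<close>] by blast
    then obtain g where g: "g \<in> hom C L (Y i)" "\<And>s. s \<in> S \<Longrightarrow> g \<cdot>\<^bsub>C\<^esub> \<iota> s = \<xi> s"
      using colim_C unfolding is_colimit_def Obj_J by blast
    \<comment> \<open>The two maps are compared on the image of \<open>\<iota>\<close> under
      \<open>U\<close>, a colimit cocone in \<open>M\<close>.\<close>
    have "amap U g = f i \<cdot>\<^bsub>M\<^esub> l"
    proof (rule colimit_ext[OF colim_M catM is_functor_func_comp[OF F functor_U]
          amap_in_hom[OF functor_U g(1)] comp_in_hom[OF catM l f_hom[OF \<open>i \<in> I\<close>]]])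
      fix s assume "s \<in> Obj ?J"
      then have s: "s \<in> S" by (simp add: Obj_J)
      show "amap U g \<cdot>\<^bsub>M\<^esub> (amap U \<circ> \<iota>) s = f i \<cdot>\<^bsub>M\<^esub> l \<cdot>\<^bsub>M\<^esub> (amap U \<circ> \<iota>) s"
        using amap_comp[OF functor_U i[OF s] g(1)] g(2)[OF s] xi(2)[OF s] li[OF s]
          assoc_hom[OF catM amap_in_hom[OF functor_U i[OF s]] l f_hom[OF \<open>i \<in> I\<close>]] by simp
    qed
    then show ?thesis using g(1) by (auto simp: is_mor_in_def)
  qed
  then have "(L, l) \<in> HO" using L l by (simp add: H_obj_def)
  then have "is_H_colimit S (L, l) \<iota>"
    using colim_C i compat li unfolding is_H_colimit_def is_colimit_def cocone_C Obj_J
    by (simp add: H_hom_def)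
  then show thesis using that by blast
qed

section \<open>Generators, weakly final objects and the final object of \<open>H\<close>\<close>

lemma mor_eqI_generating:
  assumes gen: "is_generating C \<G>" and E: "E \<in> HO"
    and u: "u \<in> hom C (fst E) Z" and v: "v \<in> hom C (fst E) Z"
    and eq: "\<And>s h. s \<in> HO \<Longrightarrow> fst s \<in> \<G> \<Longrightarrow> h \<in> H_hom s E \<Longrightarrow> u \<cdot>\<^bsub>C\<^esub> h = v \<cdot>\<^bsub>C\<^esub> h"
  shows "u = v"
proof (rule ccontr)
  assume "u \<noteq> v"
  then obtain G h where G: "G \<in> \<G>" and h: "h \<in> hom C G (fst E)" and neq: "u \<cdot>\<^bsub>C\<^esub> h \<noteq> v \<cdot>\<^bsub>C\<^esub> h"
    using gen u v hom_in_Obj[OF catC u] unfolding is_generating_def by blast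
  \<comment> \<open>A separating morphism from a generator becomes an arrow of \<open>H\<close> once
    its source is given the induced map to \<open>N\<close>.\<close>
  have "h \<in> H_hom (G, snd E \<cdot>\<^bsub>M\<^esub> amap U h) E"
    using h by (simp add: H_hom_def)
  then show False using eq H_obj_precomp[OF E h] G neq by (metis fst_conv)
qed

text \<open>Each \<open>E\<close> maps to the colimit \<open>R\<close> of the diagram enlarged by
  \<open>E\<close>. The comparison \<open>e\<close> from \<open>L\<close> to \<open>R\<close> is
  epi, so the object of \<open>R\<close> is isomorphic to one of a small set of chosen codomains,
  and the map to \<open>N\<close> moves along the isomorphism.\<close>

lemma weakly_final_objects:
  assumes cwp: "co_wellpowered T C" and gen: "is_generating C \<G>" and small: "small T \<G>"
  obtains X where "small T X" and "\<And>E. E \<in> HO \<Longrightarrow> \<exists>t h. t \<in> HO \<and> fst t \<in> X \<and> h \<in> H_hom E t"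
proof -
  let ?S = "{s \<in> HO. fst s \<in> \<G>}"
  have S: "small T ?S" using small by (rule small_H_obj_over)
  obtain L \<iota> where L: "is_H_colimit ?S L \<iota>"
    using H_colimit_exists[OF _ S] by blast
  note LO = HO_D(1)[OF H_colimit_D(1)[OF L]]
  \<comment> \<open>One codomain per equivalence class of epis out of \<open>fst L\<close>, so that
    co-wellpoweredness makes \<open>X\<close> small.\<close>
  define X where "X = (\<lambda>c. Cod C (SOME e. e \<in> c)) ` (epis_from C (fst L) // epi_equiv C (fst L))"
  have "small T X"
    unfolding X_def using cwp LO by (simp add: co_wellpowered_def small_image)
  moreover have "\<exists>t h. t \<in> HO \<and> fst t \<in> X \<and> h \<in> H_hom E t" if E: "E \<in> HO" for E
  proof -
    obtain R \<rho> where R: "is_H_colimit (insert E ?S) R \<rho>"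
      using H_colimit_exists[OF _ small_insert[OF univ S]] E by blast
    note RO = H_colimit_D(1)[OF R] and rho = H_hom_D(1)[OF H_colimit_D(2)[OF R]]
    \<comment> \<open>The components \<open>\<rho>\<close> on \<open>?S\<close> are compatible and
      hence factor through \<open>L\<close>.\<close>
    have "\<exists>e. e \<in> hom C (fst L) (fst R) \<and> (\<forall>s\<in>?S. e \<cdot>\<^bsub>C\<^esub> \<iota> s = \<rho> s)"
      by (rule H_colimit_factor[OF L HO_D(1)[OF RO], of \<rho>])
        (use rho H_colimit_D(3)[OF R] in auto)
    then obtain e where e: "e \<in> hom C (fst L) (fst R)"
      and ei: "\<And>s. s \<in> ?S \<Longrightarrow> e \<cdot>\<^bsub>C\<^esub> \<iota> s = \<rho> s"
      by blast
    have Cod_e: "Cod C e = fst R" "Dom C e = fst L" "e \<in> Arr C"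
      using e by (auto simp: hom_def)
    \<comment> \<open>\<open>e\<close> is epi: equality after \<open>e\<close> gives equality after
      \<open>\<rho> s\<close> for all \<open>s\<close> in \<open>?S\<close>, and arrows from these
      \<open>s\<close> to \<open>E\<close> detect equality after \<open>\<rho> E\<close>.\<close>
    have "x = y" if x: "x \<in> hom C (fst R) Z" and y: "y \<in> hom C (fst R) Z"
      and xy: "x \<cdot>\<^bsub>C\<^esub> e = y \<cdot>\<^bsub>C\<^esub> e" for Z x y
    proof -
      have on_S: "x \<cdot>\<^bsub>C\<^esub> \<rho> s = y \<cdot>\<^bsub>C\<^esub> \<rho> s" if s: "s \<in> ?S" for s
        using assoc_hom[OF catC H_hom_D(1)[OF H_colimit_D(2)[OF L s]] e] x y xy ei[OF s] by metis
      have rE: "\<rho> E \<in> hom C (fst E) (fst R)" using rho by simp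
      have "x \<cdot>\<^bsub>C\<^esub> \<rho> E = y \<cdot>\<^bsub>C\<^esub> \<rho> E"
      proof (rule mor_eqI_generating[OF gen E comp_in_hom[OF catC rE x] comp_in_hom[OF catC rE y]])
        fix s h assume s: "s \<in> HO" "fst s \<in> \<G>" and h: "h \<in> H_hom s E"
        have "\<rho> E \<cdot>\<^bsub>C\<^esub> h = \<rho> s" using H_colimit_D(3)[OF R _ _ h] s by simp
        then show "x \<cdot>\<^bsub>C\<^esub> \<rho> E \<cdot>\<^bsub>C\<^esub> h = y \<cdot>\<^bsub>C\<^esub> \<rho> E \<cdot>\<^bsub>C\<^esub> h"
          using assoc_hom[OF catC H_hom_D(1)[OF h] rE] x y on_S s by simp
      qed
      then show ?thesis using H_colimit_ext[OF R x y] on_S by blast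
    qed
    then have epi: "e \<in> epis_from C (fst L)"
      by (simp add: epis_from_def is_epi_def Cod_e)
    let ?c = "epi_equiv C (fst L) `` {e}"
    have Id_R: "Id C (fst R) \<in> hom C (fst R) (fst R)"
      using Id_in_hom[OF catC HO_D(1)[OF RO]] .
    then have "is_iso C (Id C (fst R))"
      using Id_comp[OF catC Id_R] by (auto simp: is_iso_def hom_def)
    \<comment> \<open>The class of \<open>e\<close> is inhabited through the identity, so its chosen
      representative is related to \<open>e\<close> by an isomorphism \<open>i\<close>.\<close>
    then have "e \<in> ?c"
      using epi Id_R Id_comp[OF catC e] by (auto simp: epi_equiv_def Cod_e)
    then have "(e, SOME e. e \<in> ?c) \<in> epi_equiv C (fst L)"
      by (metis Image_singleton_iff someI)
    then obtain i where i: "i \<in> hom C (fst R) (Cod C (SOME e. e \<in> ?c))" and iso: "is_iso C i"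
      by (auto simp: epi_equiv_def Cod_e)
    let ?X = "Cod C (SOME e. e \<in> ?c)"
    have "Dom C i = fst R" "Cod C i = ?X" using i by (auto simp: hom_def)
    then obtain j where j: "j \<in> hom C ?X (fst R)" and ji: "j \<cdot>\<^bsub>C\<^esub> i = Id C (fst R)"
      using iso unfolding is_iso_def by auto
    \<comment> \<open>The map of \<open>R\<close> to \<open>N\<close> is carried over by the left
      inverse \<open>j\<close> of \<open>i\<close>, which makes \<open>i\<close> an arrow of
      \<open>H\<close>.\<close>
    let ?t = "(?X, snd R \<cdot>\<^bsub>M\<^esub> amap U j)"
    have t: "?t \<in> HO" using H_obj_precomp[OF RO j] .
    have "snd R \<cdot>\<^bsub>M\<^esub> amap U j \<cdot>\<^bsub>M\<^esub> amap U i = snd R"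
      using assoc_hom[OF catM amap_in_hom[OF functor_U i] amap_in_hom[OF functor_U j] HO_D(2)[OF RO]]
        amap_comp[OF functor_U i j] ji H_hom_D(2)[OF Id_in_H_hom[OF RO]] by simp
    then have "i \<in> H_hom R ?t" using i by (simp add: H_hom_def)
    then have "i \<cdot>\<^bsub>C\<^esub> \<rho> E \<in> H_hom E ?t"
      using H_hom_comp[OF t H_colimit_D(2)[OF R]] by simp
    moreover have "fst ?t \<in> X"
      unfolding X_def fst_conv using quotientI[OF epi] by (rule imageI)
    ultimately show ?thesis using t by blast
  qed
  ultimately show thesis using that by blast
qed

text \<open>
  The colimit \<open>L\<close> of a weakly final small full subcategory is a retract, via \<open>\<iota> t \<circ> k\<close>, of one of
  its members \<open>t\<close>. Hence all maps from a member \<open>s\<close> to \<open>L\<close> coincide with \<open>\<iota> s\<close>, and as the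
  members include all pairs over generators, maps into \<open>L\<close> are unique.
\<close>

lemma final_H_exists:
  assumes cwp: "co_wellpowered T C" and gen: "is_generating C \<G>" and small: "small T \<G>"
  shows "\<exists>L. is_final H L"
proof -
  obtain X where X: "small T X"
    and weak: "\<And>E. E \<in> HO \<Longrightarrow> \<exists>t h. t \<in> HO \<and> fst t \<in> X \<and> h \<in> H_hom E t"
    using weakly_final_objects[OF assms] by blast
  let ?S = "{s \<in> HO. fst s \<in> \<G> \<union> X}"
  have "small T ?S"
    using small_H_obj_over[OF small_Un[OF univ small X]] .
  then obtain L \<iota> where L: "is_H_colimit ?S L \<iota>"
    using H_colimit_exists by (metis (no_types, lifting) mem_Collect_eq subsetI)
  note LO = H_colimit_D(1)[OF L] and i = H_colimit_D(2)[OF L]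
  obtain t k where t: "t \<in> ?S" and k: "k \<in> H_hom L t"
    using weak[OF LO] by blast
  \<comment> \<open>\<open>k\<close> after \<open>h\<close> is an arrow between the members
    \<open>s\<close> and \<open>t\<close> of the diagram, so the cocone identity for
    \<open>\<iota>\<close> applies.\<close>
  have retract: "\<iota> t \<cdot>\<^bsub>C\<^esub> (k \<cdot>\<^bsub>C\<^esub> h) = \<iota> s" if s: "s \<in> ?S" and h: "h \<in> H_hom s L" for s h
    using H_colimit_D(3)[OF L s t] H_hom_comp[OF _ h k] t by blast
  note ik = comp_in_hom[OF catC H_hom_D(1)[OF k] H_hom_D(1)[OF i[OF t]]]
  have "\<iota> t \<cdot>\<^bsub>C\<^esub> k = Id C (fst L)"
  proof (rule H_colimit_ext[OF L ik Id_in_hom[OF catC HO_D(1)[OF LO]]])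
    fix s assume s: "s \<in> ?S"
    show "\<iota> t \<cdot>\<^bsub>C\<^esub> k \<cdot>\<^bsub>C\<^esub> \<iota> s = Id C (fst L) \<cdot>\<^bsub>C\<^esub> \<iota> s"
      using assoc_hom[OF catC H_hom_D(1)[OF i[OF s]] H_hom_D(1)[OF k] H_hom_D(1)[OF i[OF t]]]
        retract[OF s i[OF s]] Id_comp[OF catC H_hom_D(1)[OF i[OF s]]] by simp
  qed
  then have unique: "h = \<iota> s" if s: "s \<in> ?S" and h: "h \<in> H_hom s L" for s h
    using assoc_hom[OF catC H_hom_D(1)[OF h] H_hom_D(1)[OF k] H_hom_D(1)[OF i[OF t]]]
      retract[OF s h] Id_comp[OF catC H_hom_D(1)[OF h]] by simp
  have "\<exists>!h. h \<in> H_hom E L" if E: "E \<in> HO" for E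
  proof (rule ex_ex1I)
    obtain s h where "s \<in> HO" "fst s \<in> X" "h \<in> H_hom E s" using weak[OF E] by blast
    then show "\<exists>h. h \<in> H_hom E L" using H_hom_comp[OF LO _ i] by blast
    fix u v assume u: "u \<in> H_hom E L" and v: "v \<in> H_hom E L"
    show "u = v"
    proof (rule mor_eqI_generating[OF gen E H_hom_D(1)[OF u] H_hom_D(1)[OF v]])
      fix s h assume s: "s \<in> HO" "fst s \<in> \<G>" and h: "h \<in> H_hom s E"
      \<comment> \<open>Both composites go from a member of \<open>?S\<close> to \<open>L\<close>
        and therefore equal \<open>\<iota> s\<close>.\<close>
      then show "u \<cdot>\<^bsub>C\<^esub> h = v \<cdot>\<^bsub>C\<^esub> h"
        using unique[OF _ H_hom_comp[OF LO h u]] unique[OF _ H_hom_comp[OF LO h v]] by simp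
    qed
  qed
  then show ?thesis using is_final_H_iff LO by blast
qed

end

subsection \<open>Limits\<close>

text \<open>Dual to \<open>colimit_ext\<close>: both maps factor the cone obtained by composing
  \<open>\<pi>\<close> with \<open>h\<close>.\<close>

lemma limit_ext:
  assumes lim: "is_limit J C F L \<pi>" and cat: "category C" and fun_F: "is_functor J C F"
    and h: "h \<in> hom C Z L" and k: "k \<in> hom C Z L"
    and eq: "\<And>a. a \<in> Obj J \<Longrightarrow> \<pi> a \<cdot>\<^bsub>C\<^esub> h = \<pi> a \<cdot>\<^bsub>C\<^esub> k"
  shows "h = k"
proof -
  have p: "\<pi> a \<in> hom C L (omap F a)" if "a \<in> Obj J" for a
    using lim that by (simp add: is_limit_def is_cone_def)
  have "is_cone J C F Z (\<lambda>a. \<pi> a \<cdot>\<^bsub>C\<^esub> h)"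
    unfolding is_cone_def
  proof (intro conjI ballI)
    show "Z \<in> Obj C" using hom_in_Obj[OF cat h] by simp
    show "\<pi> a \<cdot>\<^bsub>C\<^esub> h \<in> hom C Z (omap F a)" if "a \<in> Obj J" for a
      using comp_in_hom[OF cat h p[OF that]] .
    fix u assume u: "u \<in> Arr J"
    then have u': "u \<in> hom J (Dom J u) (Cod J u)" by (simp add: hom_def)
    have "category J" using fun_F by (simp add: is_functor_def)
    then have "Dom J u \<in> Obj J" using hom_in_Obj u' by metis
    moreover have "amap F u \<cdot>\<^bsub>C\<^esub> \<pi> (Dom J u) = \<pi> (Cod J u)"
      using lim u by (simp add: is_limit_def is_cone_def)
    ultimately show "amap F u \<cdot>\<^bsub>C\<^esub> (\<pi> (Dom J u) \<cdot>\<^bsub>C\<^esub> h) = \<pi> (Cod J u) \<cdot>\<^bsub>C\<^esub> h"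
      using assoc_hom[OF cat h p amap_in_hom[OF fun_F u']] by simp
  qed
  then have "\<exists>!g. g \<in> hom C Z L \<and> (\<forall>a\<in>Obj J. \<pi> a \<cdot>\<^bsub>C\<^esub> g = \<pi> a \<cdot>\<^bsub>C\<^esub> h)"
    using lim by (simp add: is_limit_def)
  then show ?thesis using h k eq by (metis (no_types, lifting))
qed

context lifting_problem
begin

text \<open>The image under \<open>U\<close> of a cone \<open>\<xi>\<close> with vertex
  \<open>X\<close> induces a map \<open>r\<close> to the limit \<open>N\<close>. Since
  \<open>f a\<close> after \<open>r\<close> is the image of \<open>\<xi> a\<close>, the pair
  \<open>(X, r)\<close> belongs to \<open>H\<close>, and finality can be applied to it.\<close>

lemma final_H_is_limit:
  assumes fun_F: "is_functor A C F" and A: "I = Obj A" and Y: "Y = omap F"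
    and lim: "is_limit A M (func_comp U F) N f" and final: "is_final H (E, p)"
  shows "is_limit A C F E (\<lambda>a. lift_mor C U E (omap F a) (f a \<cdot>\<^bsub>M\<^esub> p))"
proof -
  define \<pi> where "\<pi> a = lift_mor C U E (omap F a) (f a \<cdot>\<^bsub>M\<^esub> p)" for a
  have EO: "(E, p) \<in> HO" and fin: "\<And>r. r \<in> HO \<Longrightarrow> \<exists>!h. h \<in> H_hom r (E, p)"
    using final is_final_H_iff by auto
  have E: "E \<in> Obj C" and p: "p \<in> hom M (omap U E) N"
    using HO_D(1,2)[OF EO] by simp_all
  have pi: "\<pi> a \<in> hom C E (omap F a)" "amap U (\<pi> a) = f a \<cdot>\<^bsub>M\<^esub> p" if "a \<in> Obj A" for a
    unfolding \<pi>_def using lift_mor_in_hom[OF catC faithful_U] HO_D(3)[OF EO] that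
    by (auto simp: A Y)
  have f: "f a \<in> hom M N (omap U (omap F a))" if "a \<in> Obj A" for a
    using f_hom that by (simp add: A Y)
  have catA: "category A" using fun_F by (simp add: is_functor_def)
  have u_hom: "amap F u \<in> hom C (omap F (Dom A u)) (omap F (Cod A u))" if "u \<in> Arr A" for u
    using fun_F that by (simp add: is_functor_def)
  \<comment> \<open>By faithfulness the cone identity may be checked in \<open>M\<close>, where it
    follows from that of \<open>f\<close>.\<close>
  have "amap F u \<cdot>\<^bsub>C\<^esub> \<pi> (Dom A u) = \<pi> (Cod A u)" if u: "u \<in> Arr A" for u
  proof (rule faithfulD[OF catC faithful_U])
    note D = category_Arr(1)[OF catA u] and D' = category_Arr(2)[OF catA u]
    show "\<pi> (Cod A u) \<in> hom C E (omap F (Cod A u))" using pi(1)[OF D'] .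
    show "amap F u \<cdot>\<^bsub>C\<^esub> \<pi> (Dom A u) \<in> hom C E (omap F (Cod A u))"
      using comp_in_hom[OF catC pi(1)[OF D] u_hom[OF u]] .
    have "amap U (amap F u) \<cdot>\<^bsub>M\<^esub> f (Dom A u) = f (Cod A u)"
      using lim u by (simp add: is_limit_def is_cone_def func_comp_def)
    then show "amap U (amap F u \<cdot>\<^bsub>C\<^esub> \<pi> (Dom A u)) = amap U (\<pi> (Cod A u))"
      using amap_comp[OF functor_U pi(1)[OF D] u_hom[OF u]]
        assoc_hom[OF catM p f[OF D] amap_in_hom[OF functor_U u_hom[OF u]]]
      by (simp add: pi(2) D D')
  qed
  then have cone: "is_cone A C F E \<pi>"
    using E pi(1) by (simp add: is_cone_def)
  \<comment> \<open>A map into \<open>N\<close> is determined by its composites with the projections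
    \<open>f a\<close>; this turns factorizations of a cone into arrows of \<open>H\<close>.\<close>
  have H_homI: "p \<cdot>\<^bsub>M\<^esub> amap U h = r"
    if h: "h \<in> hom C X E" and r: "r \<in> hom M (omap U X) N"
      and eq: "\<And>a. a \<in> Obj A \<Longrightarrow> amap U (\<pi> a \<cdot>\<^bsub>C\<^esub> h) = f a \<cdot>\<^bsub>M\<^esub> r" for h r X
  proof (rule limit_ext[OF lim catM is_functor_func_comp[OF fun_F functor_U] _ r])
    show "p \<cdot>\<^bsub>M\<^esub> amap U h \<in> hom M (omap U X) N"
      using comp_in_hom[OF catM amap_in_hom[OF functor_U h] p] .
    show "f a \<cdot>\<^bsub>M\<^esub> (p \<cdot>\<^bsub>M\<^esub> amap U h) = f a \<cdot>\<^bsub>M\<^esub> r" if a: "a \<in> Obj A" for a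
      using eq[OF a] amap_comp[OF functor_U h pi(1)[OF a]] pi(2)[OF a]
        assoc_hom[OF catM amap_in_hom[OF functor_U h] p f[OF a]] by simp
  qed
  have "\<exists>!h. h \<in> hom C X E \<and> (\<forall>a\<in>Obj A. \<pi> a \<cdot>\<^bsub>C\<^esub> h = \<xi> a)" if X: "is_cone A C F X \<xi>" for X \<xi>
  proof -
    have xi: "\<xi> a \<in> hom C X (omap F a)" if "a \<in> Obj A" for a
      using X that by (simp add: is_cone_def)
    have "amap U (amap F u) \<cdot>\<^bsub>M\<^esub> amap U (\<xi> (Dom A u)) = amap U (\<xi> (Cod A u))" if u: "u \<in> Arr A" for u
      using amap_comp[OF functor_U xi[OF category_Arr(1)[OF catA u]] u_hom[OF u]] X u
      by (simp add: is_cone_def)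
    moreover have XO: "X \<in> Obj C" using X by (simp add: is_cone_def)
    ultimately have "is_cone A M (func_comp U F) (omap U X) (amap U \<circ> \<xi>)"
      using amap_in_hom[OF functor_U xi] omap_in_Obj[OF functor_U]
      by (simp add: is_cone_def func_comp_def)
    then obtain r where r: "r \<in> hom M (omap U X) N" and fr: "\<And>a. a \<in> Obj A \<Longrightarrow> f a \<cdot>\<^bsub>M\<^esub> r = amap U (\<xi> a)"
      using lim unfolding is_limit_def comp_def by blast
    have "(X, r) \<in> HO"
      using XO r fr xi by (auto simp: H_obj_def is_mor_in_def A Y)
    then have ex1: "\<exists>!h. h \<in> H_hom (X, r) (E, p)" by (rule fin)
    \<comment> \<open>Arrows from \<open>(X, r)\<close> to \<open>(E, p)\<close> and factorizations
      of \<open>\<xi>\<close> through \<open>\<pi>\<close> are the same morphisms of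
      \<open>C\<close>, so finality becomes the universal property.\<close>
    have "h \<in> H_hom (X, r) (E, p) \<longleftrightarrow> h \<in> hom C X E \<and> (\<forall>a\<in>Obj A. \<pi> a \<cdot>\<^bsub>C\<^esub> h = \<xi> a)" for h
    proof (intro iffI conjI ballI)
      assume h: "h \<in> H_hom (X, r) (E, p)"
      then show h': "h \<in> hom C X E" by (simp add: H_hom_def)
      fix a assume a: "a \<in> Obj A"
      show "\<pi> a \<cdot>\<^bsub>C\<^esub> h = \<xi> a"
      proof (rule faithfulD[OF catC faithful_U comp_in_hom[OF catC h' pi(1)[OF a]] xi[OF a]])
        show "amap U (\<pi> a \<cdot>\<^bsub>C\<^esub> h) = amap U (\<xi> a)"
          using amap_comp[OF functor_U h' pi(1)[OF a]] pi(2)[OF a] fr[OF a] H_hom_D(2)[OF h]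
            assoc_hom[OF catM amap_in_hom[OF functor_U h'] p f[OF a]] by simp
      qed
    next
      assume "h \<in> hom C X E \<and> (\<forall>a\<in>Obj A. \<pi> a \<cdot>\<^bsub>C\<^esub> h = \<xi> a)"
      then show "h \<in> H_hom (X, r) (E, p)"
        using H_homI[OF _ r, of h] fr by (simp add: H_hom_def)
    qed
    then show ?thesis using ex1 by simp
  qed
  then have "is_limit A C F E \<pi>" using cone by (simp add: is_limit_def)
  then show ?thesis unfolding \<pi>_def .
qed

end

theorem mainTheorem2:
  fixes C :: "('oc, 'mc) cat"
    and M :: "('om, 'mm) cat"
    and U :: "('oc, 'mc, 'om, 'mm) func"
    and zC :: 'oc and zM :: 'om
  assumes "universe TYPE('u)"
    and "category C" and "locally_small TYPE('u) C" and "cocomplete_cat TYPE('u) C"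
    and "category M" and "locally_small TYPE('u) M" and "cocomplete_cat TYPE('u) M"
    and "is_functor C M U" and "is_faithful C U" and "preserves_colimits TYPE('u) C M U"
    and "complete_cat TYPE('u) M"
    and "co_wellpowered TYPE('u) C"
    and "\<exists>\<G>. small TYPE('u) \<G> \<and> is_generating C \<G>"
    and "is_initial C zC" and "is_initial M zM" and "omap U zC = zM"
  shows "complete_cat TYPE('u) C \<and>
    (\<forall>(A :: ('a, 'b) cat) F P q.
       small_category TYPE('u) A \<longrightarrow> is_functor A C F \<longrightarrow> is_limit A M (func_comp U F) P q \<longrightarrow>
         (\<exists>H0. is_final (H_cat C M U P (Obj A) (omap F) q) H0) \<and>
         (\<forall>E0 p0. is_final (H_cat C M U P (Obj A) (omap F) q) (E0, p0) \<longrightarrow>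
            (\<forall>a\<in>Obj A. is_mor_in C U E0 (omap F a) (q a \<cdot>\<^bsub>M\<^esub> p0)) \<and>
            is_limit A C F E0 (\<lambda>a. lift_mor C U E0 (omap F a) (q a \<cdot>\<^bsub>M\<^esub> p0))))"
proof -
  \<comment> \<open>The types of the shape are left general: the facts below serve both for shapes
    on \<open>'u\<close>, which completeness asks for, and for shapes on \<open>'a\<close> and
    \<open>'b\<close>.\<close>
  have setting: "lifting_problem TYPE('u) C M U P (Obj A) (omap F) q"
    if "is_functor A C F" and "is_limit A M (func_comp U F) P q"
    for A :: "('x, 'y) cat" and F P q
    using that assms omap_in_Obj[OF that(1)]
    by unfold_locales (auto simp: is_limit_def is_cone_def func_comp_def)
  have final: "\<exists>H0. is_final (H_cat C M U P (Obj A) (omap F) q) H0"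
    if "is_functor A C F" and "is_limit A M (func_comp U F) P q"
    for A :: "('x, 'y) cat" and F P q
    using lifting_problem.final_H_exists[OF setting[OF that]] assms by blast
  have limit: "is_limit A C F E0 (\<lambda>a. lift_mor C U E0 (omap F a) (q a \<cdot>\<^bsub>M\<^esub> p0))"
    if "is_functor A C F" and "is_limit A M (func_comp U F) P q"
      and "is_final (H_cat C M U P (Obj A) (omap F) q) (E0, p0)"
    for A :: "('x, 'y) cat" and F P q E0 p0
    using lifting_problem.final_H_is_limit[OF setting[OF that(1,2)] that(1) refl refl that(2,3)] .
  have complete: "complete_cat TYPE('u) C"
    unfolding complete_cat_def
  proof (intro allI impI, elim conjE)
    fix J :: "('u, 'u) cat" and F :: "('u, 'u, 'oc, 'mc) func"
    assume J: "small_category TYPE('u) J" and F: "is_functor J C F"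
    have "is_functor J M (func_comp U F)"
      using is_functor_func_comp[OF F] assms by blast
    then obtain P q where lim: "is_limit J M (func_comp U F) P q"
      using assms J unfolding complete_cat_def by blast
    then show "\<exists>L \<pi>. is_limit J C F L \<pi>"
      using final[OF F lim] limit[OF F lim] by fast
  qed
  have mor: "is_mor_in C U E0 (omap F a) (q a \<cdot>\<^bsub>M\<^esub> p0)"
    if "is_final (H_cat C M U P (Obj A) (omap F) q) (E0, p0)" and "a \<in> Obj A"
    for A :: "('x, 'y) cat" and F P q E0 p0 a
    using that by (simp add: is_final_def H_cat_def H_obj_def)
  show ?thesis
  proof (intro conjI allI impI ballI)
    show "complete_cat TYPE('u) C" by (rule complete)
    fix A :: "('a, 'b) cat" and F P q
    assume F: "is_functor A C F" and lim: "is_limit A M (func_comp U F) P q"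
    show "\<exists>H0. is_final (H_cat C M U P (Obj A) (omap F) q) H0"
      using final[OF F lim] .
    fix E0 p0 assume fin: "is_final (H_cat C M U P (Obj A) (omap F) q) (E0, p0)"
    show "is_limit A C F E0 (\<lambda>a. lift_mor C U E0 (omap F a) (q a \<cdot>\<^bsub>M\<^esub> p0))"
      using limit[OF F lim fin] .
    show "is_mor_in C U E0 (omap F a) (q a \<cdot>\<^bsub>M\<^esub> p0)" if "a \<in> Obj A" for a
      using mor[OF fin that] .
  qed
qed

end
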